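(* Let $\mathcal{P}$ be the class of distributions $\mathbb{P}$ on $W\times C$ such that for all $w\in W$ the conditional distribution $\mathbb{P}[\cdot\mid w]$ of $c$ is square integrable and $\mathbb{E}[c\mid w]\in\operatorname{Conv}(C)$, and assume $B_C:=\max_{c\in C}\|c\|_2<\infty$. For each $j\in\{1,\dots,m\}$, let $\ell_j:\mathbb{R}\times\mathbb{R}\to\mathbb{R}$ be a loss function such that there exists a non-decreasing function $\eta_j:(0,\infty)\to(0,\infty)$ that satisfies $$\mathbb{E}[(g_j(w)-c_j)^2]-\inf_{g_j'}\mathbb{E}[(g_j'(w)-c_j)^2]\le\eta_j\left(\mathbb{E}[\ell_j(g_j(w),c_j)]-\inf_{g_j'}\mathbb{E}[\ell_j(g_j'(w),c_j)]\right)$$ for any $g_j:W\to\mathbb{R}$ and $\mathbb{P}\in\mathcal{P}$. Then, denoting $g=(g_1,\dots,g_m)$, $$R(g,\mathbb{P})-R(\mathbb{P})\le B_X\sqrt{\sum_{j=1}^m\eta_j\left(\mathbb{E}[\ell_j(g_j(w),c_j)]-\inf_{g_j'}\mathbb{E}[\ell_j(g_j'(w),c_j)]\right)}$$ for any such $g_1,\dots,g_m$ and any $\mathbb{P}\in\mathcal{P}$.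
   Context: Setting: $X\subset\mathbb{R}^m$ is a non-empty convex compact set with Euclidean diameter $B_X:=\max_{x,x'\in X}\|x-x'\|_2$; $f:X\to\mathbb{R}$ is convex and continuous; $W\subseteq\mathbb{R}^k$ and $C\subseteq\mathbb{R}^m$ are given sets. For $d\in\mathbb{R}^m$, $X^*(d):=\operatorname{argmin}_{x\in X}\{f(x)+d^\top x\}$, and $x^*:\mathbb{R}^m\to X$ is a fixed function with $x^*(d)\in X^*(d)$ for all $d$ (any such selection is Lebesgue measurable). The true loss is $L(d,c):=f(x^*(d))+c^\top x^*(d)-\min_{x\in X}\{f(x)+c^\top x\}$. Probability distributions $\mathbb{P}$ on $W\times C$ are defined on the $\sigma$-algebra of Lebesgue measurable sets; $(w,c)\sim\mathbb{P}$, $c_j$ is the $j$-th component of $c$, and $\mathbb{E}[\cdot\mid w]$ is conditional expectation given $w$. For measurable $g:W\to\mathbb{R}^m$: $R(g,\mathbb{P}):=\mathbb{E}[L(g(w),c)]$ and $R(\mathbb{P}):=\inf\{R(g,\mathbb{P}):g\text{ measurable}\}$. All functions $g_j$, $g_j'$ and losses $\ell_j$ are measurable, and infima over $g_j'$ are over measurable $g_j':W\to\mathbb{R}$.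
   Formalization: Since x*∘g need not be measurable for Lebesgue measurable g (then R(g,P) is undefined), g and the competitors in R(P) are those with x*∘g measurable; the ℓ_j-excesses of g_j are assumed finite so that η_j applies, and η_j(0) is an arbitrary value. *)

theory Defs
  imports "HOL-Probability.Probability"
begin

definition argmin_set :: "(real^'m) set \<Rightarrow> (real^'m \<Rightarrow> real) \<Rightarrow> real^'m \<Rightarrow> (real^'m) set" where
  "argmin_set X f d = {x. is_arg_min (\<lambda>x. f x + d \<bullet> x) (\<lambda>x. x \<in> X) x}"

text \<open>
  In all applications the set \<open>X\<close> is non-empty and compact and \<open>f\<close> is continuous on it, so the
  infimum is attained.  The argument \<open>xs\<close> is the selection of minimizers.
\<close>

definition true_loss ::
  "(real^'m) set \<Rightarrow> (real^'m \<Rightarrow> real) \<Rightarrow> (real^'m \<Rightarrow> real^'m) \<Rightarrow> real^'m \<Rightarrow> real^'m \<Rightarrow> real" where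
  "true_loss X f xs d c = f (xs d) + c \<bullet> xs d - (INF x\<in>X. f x + c \<bullet> x)"

text \<open>
  \<open>K\<close> is a version of the conditional distribution of \<open>c\<close> given \<open>w\<close>: membership in the function
  space over the probability algebra says that, for every \<open>w \<in> W\<close>, \<open>K w\<close> is a probability measure
  on the Lebesgue measurable subsets of \<open>C\<close>, depending measurably on \<open>w\<close>.  The disintegration
  identity is imposed on measurable rectangles, since the sections of a Lebesgue measurable set
  need not all be measurable.
\<close>

definition is_cond_distr ::
  "(real^'k) set \<Rightarrow> (real^'m) set \<Rightarrow> ((real^'k) \<times> (real^'m)) measure \<Rightarrow> (real^'k \<Rightarrow> (real^'m) measure) \<Rightarrow> bool" where
  "is_cond_distr W C P K \<longleftrightarrow>
     K \<in> lebesgue_on W \<rightarrow>\<^sub>M prob_algebra (lebesgue_on C) \<and>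
     (\<forall>B\<in>sets (lebesgue_on W). \<forall>A\<in>sets (lebesgue_on C).
        emeasure P (B \<times> A) = (\<integral>\<^sup>+w\<in>B. emeasure (K w) A \<partial>distr P (lebesgue_on W) fst))"

definition distribution_class ::
  "(real^'k) set \<Rightarrow> (real^'m) set \<Rightarrow> ((real^'k) \<times> (real^'m)) measure set" where
  "distribution_class W C =
     {P. prob_space P \<and> sets P = sets (lebesgue_on (W \<times> C)) \<and>
         (\<exists>K. is_cond_distr W C P K \<and>
              (\<forall>w\<in>W. integrable (K w) (\<lambda>c. (norm c)\<^sup>2) \<and>
                     (\<integral>c. c \<partial>K w) \<in> convex hull C))}"

text \<open>
  Measurable predictors \<open>g\<close> for which the decision rule \<open>xs \<circ> g\<close> is measurable as well.  A selection
  \<open>xs\<close> is always Lebesgue measurable, but the composition of Lebesgue measurable functions need not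
  be, and without it the expected true loss of \<open>g\<close> is not defined.  If \<open>xs\<close> is Borel measurable,
  the second condition is automatic.
\<close>

definition predictors ::
  "(real^'k) set \<Rightarrow> (real^'m \<Rightarrow> real^'m) \<Rightarrow> (real^'k \<Rightarrow> real^'m) set" where
  "predictors W xs =
     {g \<in> borel_measurable (lebesgue_on W). (\<lambda>w. xs (g w)) \<in> borel_measurable (lebesgue_on W)}"

lemma predictors_borel:
  assumes "xs \<in> borel_measurable borel"
  shows "predictors W xs = borel_measurable (lebesgue_on W)"
  unfolding predictors_def using measurable_compose[OF _ assms] by auto

definition risk ::
  "(real^'m) set \<Rightarrow> (real^'m \<Rightarrow> real) \<Rightarrow> (real^'m \<Rightarrow> real^'m) \<Rightarrow> (real^'k \<Rightarrow> real^'m)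
     \<Rightarrow> ((real^'k) \<times> (real^'m)) measure \<Rightarrow> real" where
  "risk X f xs g P = (\<integral>(w, c). true_loss X f xs (g w) c \<partial>P)"

definition optimal_risk ::
  "(real^'k) set \<Rightarrow> (real^'m) set \<Rightarrow> (real^'m \<Rightarrow> real) \<Rightarrow> (real^'m \<Rightarrow> real^'m)
     \<Rightarrow> ((real^'k) \<times> (real^'m)) measure \<Rightarrow> real" where
  "optimal_risk W X f xs P = (INF g\<in>predictors W xs. risk X f xs g P)"

text \<open>
  Expectation with values in the extended reals.  It is \<open>\<infinity>\<close> when it is undefined, that is, for a
  non-measurable integrand or when both the positive and the negative part have infinite integral
  (\<open>\<infinity> - \<infinity> = \<infinity>\<close> holds in \<^typ>\<open>ereal\<close>); such integrands thus do not contribute to an infimum.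
\<close>

definition ext_expectation :: "'a measure \<Rightarrow> ('a \<Rightarrow> real) \<Rightarrow> ereal" where
  "ext_expectation M h =
     (if h \<in> borel_measurable M
      then enn2ereal (\<integral>\<^sup>+x. ennreal (h x) \<partial>M) - enn2ereal (\<integral>\<^sup>+x. ennreal (- h x) \<partial>M)
      else \<infinity>)"

lemma ext_expectation_integrable:
  assumes "integrable M h"
  shows "ext_expectation M h = ereal (integral\<^sup>L M h)"
proof -
  have "(\<integral>\<^sup>+x. ennreal (h x) \<partial>M) \<noteq> \<infinity>" "(\<integral>\<^sup>+x. ennreal (- h x) \<partial>M) \<noteq> \<infinity>"
    using assms by (auto simp: real_integrable_def)
  moreover have "h \<in> borel_measurable M"
    using assms by auto
  ultimately show ?thesis
    using real_lebesgue_integral_def[OF assms]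
    by (cases "\<integral>\<^sup>+x. ennreal (h x) \<partial>M"; cases "\<integral>\<^sup>+x. ennreal (- h x) \<partial>M")
       (auto simp: ext_expectation_def)
qed

definition expected_loss ::
  "((real^'k) \<times> (real^'m)) measure \<Rightarrow> (real \<times> real \<Rightarrow> real) \<Rightarrow> 'm \<Rightarrow> (real^'k \<Rightarrow> real) \<Rightarrow> ereal" where
  "expected_loss P l j h = ext_expectation P (\<lambda>(w, c). l (h w, c $ j))"

text \<open>
  By the conventions of \<^typ>\<open>ereal\<close>, the excess is finite if and only if both the expected loss of
  \<open>h\<close> and the infimum are finite.
\<close>

definition excess ::
  "(real^'k) set \<Rightarrow> ((real^'k) \<times> (real^'m)) measure \<Rightarrow> (real \<times> real \<Rightarrow> real) \<Rightarrow> 'm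
     \<Rightarrow> (real^'k \<Rightarrow> real) \<Rightarrow> ereal" where
  "excess W P l j h =
     expected_loss P l j h - (INF h'\<in>borel_measurable (lebesgue_on W). expected_loss P l j h')"

lemma excess_finite_iff:
  "\<bar>excess W P l j h\<bar> \<noteq> \<infinity> \<longleftrightarrow>
     \<bar>expected_loss P l j h\<bar> \<noteq> \<infinity> \<and>
     \<bar>INF h'\<in>borel_measurable (lebesgue_on W). expected_loss P l j h'\<bar> \<noteq> \<infinity>"
  unfolding excess_def
  by (cases "expected_loss P l j h";
      cases "INF h'\<in>borel_measurable (lebesgue_on W). expected_loss P l j h'") auto

definition squared_loss :: "real \<times> real \<Rightarrow> real" where
  "squared_loss = (\<lambda>(a, b). (a - b)\<^sup>2)"

end

theory Submission
  imports Defs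
begin

text \<open>
  Write \<open>\<mu>(w)\<close> for the conditional mean of \<open>c\<close> given \<open>w\<close>.  Calibration is applied at \<open>P\<close> itself, and the
  excess squared loss of \<open>g\<^sub>j\<close> dominates \<open>E[(g\<^sub>j(w) - \<mu>\<^sub>j(w))\<^sup>2]\<close>, since \<open>\<mu>\<^sub>j\<close> competes in the infimum.
  For a competing predictor \<open>g'\<close>, with \<open>y = xs (g w)\<close> and \<open>y' = xs (g' w)\<close>, the optimality of \<open>y\<close> for
  the cost vector \<open>g w\<close> bounds the conditional risk difference \<open>f y - f y' + \<mu> \<bullet> (y - y')\<close> by
  \<open>(\<mu> - g w) \<bullet> (y - y')\<close>, hence by \<open>norm (\<mu> - g w) * diameter X\<close>; Jensen's inequality finishes the proof.
\<close>

section \<open>Lebesgue measurability of the coordinate projections\<close>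

text \<open>The target is a completion, so Borel measurability is not enough: preimages of null sets
  must be null as well. Here such a preimage is a cylinder over a null set, which is null in the
  product.\<close>

lemma measurable_lebesgue_fst:
  "(fst :: 'a::euclidean_space \<times> 'b::euclidean_space \<Rightarrow> 'a) \<in> lebesgue \<rightarrow>\<^sub>M lebesgue"
proof -
  have f: "(fst :: 'a \<times> 'b \<Rightarrow> 'a) \<in> lebesgue \<rightarrow>\<^sub>M lborel"
    by (intro measurable_completion) (simp add: borel_prod[symmetric])
  show ?thesis
  proof (rule completion.measurable_completion2[OF f], intro subsetI)
    fix B :: "'a set" assume B: "B \<in> null_sets lborel"
    then have "B \<times> UNIV \<in> null_sets (lborel \<Otimes>\<^sub>M (lborel :: 'b measure))"
      by (intro lborel.times_in_null_sets1) auto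
    then have "B \<times> (UNIV :: 'b set) \<in> null_sets lebesgue"
      by (simp only: lborel_prod null_sets_completionI)
    moreover have "fst -` B = B \<times> (UNIV :: 'b set)" by auto
    ultimately show "B \<in> null_sets (distr lebesgue lborel (fst :: 'a \<times> 'b \<Rightarrow> 'a))"
      using B f by (subst null_sets_distr_iff) (auto simp: null_sets_def)
  qed
qed

lemma measurable_lebesgue_snd:
  "(snd :: 'a::euclidean_space \<times> 'b::euclidean_space \<Rightarrow> 'b) \<in> lebesgue \<rightarrow>\<^sub>M lebesgue"
proof -
  have f: "(snd :: 'a \<times> 'b \<Rightarrow> 'b) \<in> lebesgue \<rightarrow>\<^sub>M lborel"
    by (intro measurable_completion) (simp add: borel_prod[symmetric])
  show ?thesis
  proof (rule completion.measurable_completion2[OF f], intro subsetI)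
    fix B :: "'b set" assume B: "B \<in> null_sets lborel"
    then have "UNIV \<times> B \<in> null_sets ((lborel :: 'a measure) \<Otimes>\<^sub>M lborel)"
      by (intro lborel.times_in_null_sets2) auto
    then have "(UNIV :: 'a set) \<times> B \<in> null_sets lebesgue"
      by (simp only: lborel_prod null_sets_completionI)
    moreover have "snd -` B = (UNIV :: 'a set) \<times> B" by auto
    ultimately show "B \<in> null_sets (distr lebesgue lborel (snd :: 'a \<times> 'b \<Rightarrow> 'b))"
      using B f by (subst null_sets_distr_iff) (auto simp: null_sets_def)
  qed
qed

section \<open>Disintegration of integrals along a kernel\<close>

text \<open>The \<sigma>-algebra of \<open>P\<close> is left open, since the Lebesgue measurable
  sets of a product exceed the product \<sigma>-algebra. \<open>P\<close> is tied to
  \<open>M\<close>, \<open>N\<close> and \<open>K\<close> only through the projections and the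
  measure of rectangles.\<close>

locale disintegration = prob_space P
  for P :: "('a \<times> 'b) measure" and M :: "'a measure" and N :: "'b measure"
    and K :: "'a \<Rightarrow> 'b measure" +
  assumes space_P: "space P = space M \<times> space N"
    and measurable_fst_P [measurable]: "fst \<in> P \<rightarrow>\<^sub>M M"
    and measurable_snd_P [measurable]: "snd \<in> P \<rightarrow>\<^sub>M N"
    and kernel: "K \<in> M \<rightarrow>\<^sub>M prob_algebra N"
    and emeasure_rectangle: "\<And>B A. B \<in> sets M \<Longrightarrow> A \<in> sets N \<Longrightarrow>
      emeasure P (B \<times> A) = (\<integral>\<^sup>+w\<in>B. emeasure (K w) A \<partial>distr P M fst)"
begin

lemma kernel_subprob [measurable]: "K \<in> M \<rightarrow>\<^sub>M subprob_algebra N"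
  using kernel by (rule measurable_prob_algebraD)

lemma sets_K: "w \<in> space M \<Longrightarrow> sets (K w) = sets N"
  using measurable_space[OF kernel_subprob] by (auto simp: space_subprob_algebra)

lemma space_K: "w \<in> space M \<Longrightarrow> space (K w) = space N"
  using sets_K sets_eq_imp_space_eq by blast

lemma prob_space_K: "w \<in> space M \<Longrightarrow> prob_space (K w)"
  using measurable_space[OF kernel] by (auto simp: space_prob_algebra)

lemma nn_integral_kernel_measurable [measurable]:
  assumes [measurable]: "u \<in> borel_measurable N"
  shows "(\<lambda>w. \<integral>\<^sup>+c. u c \<partial>K w) \<in> borel_measurable M"
  by (rule measurable_compose[OF kernel_subprob]) measurable

lemma integral_kernel_measurable [measurable]:
  fixes u :: "'b \<Rightarrow> real"
  assumes [measurable]: "u \<in> borel_measurable N"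
  shows "(\<lambda>w. \<integral>c. u c \<partial>K w) \<in> borel_measurable M"
  by (rule measurable_compose[OF kernel_subprob]) measurable

text \<open>First half of a two-stage induction: the factor in \<open>w\<close> stays an indicator
  while \<open>u\<close> is built up from indicators.\<close>

lemma nn_integral_indicator_disintegrate:
  assumes B [measurable]: "B \<in> sets M" and u: "u \<in> borel_measurable N"
  shows "(\<integral>\<^sup>+x. indicator B (fst x) * u (snd x) \<partial>P) =
    (\<integral>\<^sup>+x. indicator B (fst x) * (\<integral>\<^sup>+c. u c \<partial>K (fst x)) \<partial>P)"
  using u
proof (induction rule: borel_measurable_induct)
  case (cong f g)
  have "(\<integral>\<^sup>+x. indicator B (fst x) * f (snd x) \<partial>P) = (\<integral>\<^sup>+x. indicator B (fst x) * g (snd x) \<partial>P)"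
    using cong(3) by (intro nn_integral_cong) (auto simp: space_P)
  moreover have "(\<integral>\<^sup>+c. f c \<partial>K w) = (\<integral>\<^sup>+c. g c \<partial>K w)" if "w \<in> space M" for w
    using cong(3) that by (intro nn_integral_cong) (auto simp: space_K)
  then have "(\<integral>\<^sup>+x. indicator B (fst x) * (\<integral>\<^sup>+c. f c \<partial>K (fst x)) \<partial>P) =
      (\<integral>\<^sup>+x. indicator B (fst x) * (\<integral>\<^sup>+c. g c \<partial>K (fst x)) \<partial>P)"
    by (intro nn_integral_cong) (auto simp: space_P)
  ultimately show ?case using cong(4) by simp
next
  \<comment> \<open>The one case that uses the disintegration identity, on the rectangle
    \<open>B \<times> A\<close>; the later cases need only linearity and monotone
    convergence.\<close>
  case (set A)
  note [measurable] = set
  have BA: "B \<times> A = {x \<in> space P. fst x \<in> B \<and> snd x \<in> A}"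
    using sets.sets_into_space[OF B] sets.sets_into_space[OF set] by (auto simp: space_P)
  have BA_sets: "B \<times> A \<in> sets P" unfolding BA by measurable
  have "(\<integral>\<^sup>+x. indicator B (fst x) * indicator A (snd x) \<partial>P) = (\<integral>\<^sup>+x. indicator (B \<times> A) x \<partial>P)"
    by (intro nn_integral_cong) (auto split: split_indicator)
  also have "\<dots> = (\<integral>\<^sup>+w\<in>B. emeasure (K w) A \<partial>distr P M fst)"
    using BA_sets emeasure_rectangle[OF B set] by simp
  also have "\<dots> = (\<integral>\<^sup>+x. emeasure (K (fst x)) A * indicator B (fst x) \<partial>P)"
    by (intro nn_integral_distr) measurable
  also have "\<dots> = (\<integral>\<^sup>+x. indicator B (fst x) * (\<integral>\<^sup>+c. indicator A c \<partial>K (fst x)) \<partial>P)"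
    using set by (intro nn_integral_cong) (simp add: space_P mem_Times_iff sets_K mult.commute)
  finally show ?case .
next
  case (mult u c)
  note [measurable] = mult.hyps(2)
  have "(\<integral>\<^sup>+x. indicator B (fst x) * (c * u (snd x)) \<partial>P) =
      c * (\<integral>\<^sup>+x. indicator B (fst x) * u (snd x) \<partial>P)"
    by (subst nn_integral_cmult[symmetric]) (auto simp: mult.left_commute)
  also have "\<dots> = (\<integral>\<^sup>+x. c * (indicator B (fst x) * (\<integral>\<^sup>+c. u c \<partial>K (fst x))) \<partial>P)"
    unfolding mult.IH by (intro nn_integral_cmult[symmetric]) measurable
  also have "\<dots> = (\<integral>\<^sup>+x. indicator B (fst x) * (\<integral>\<^sup>+a. c * u a \<partial>K (fst x)) \<partial>P)"
    using mult.hyps(2) by (intro nn_integral_cong)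
      (auto simp: space_P sets_K nn_integral_cmult mult.left_commute cong: measurable_cong_sets)
  finally show ?case .
next
  case (add u v)
  note [measurable] = add.hyps(1,3)
  have "(\<integral>\<^sup>+x. indicator B (fst x) * (v (snd x) + u (snd x)) \<partial>P) =
      (\<integral>\<^sup>+x. indicator B (fst x) * v (snd x) \<partial>P) + (\<integral>\<^sup>+x. indicator B (fst x) * u (snd x) \<partial>P)"
    by (subst nn_integral_add[symmetric]) (auto simp: distrib_left)
  also have "\<dots> = (\<integral>\<^sup>+x. indicator B (fst x) * (\<integral>\<^sup>+c. v c \<partial>K (fst x)) +
      indicator B (fst x) * (\<integral>\<^sup>+c. u c \<partial>K (fst x)) \<partial>P)"
    unfolding add.IH by (intro nn_integral_add[symmetric]) measurable
  also have "\<dots> = (\<integral>\<^sup>+x. indicator B (fst x) * (\<integral>\<^sup>+c. v c + u c \<partial>K (fst x)) \<partial>P)"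
    using add.hyps(1,3) by (intro nn_integral_cong)
      (auto simp: space_P sets_K nn_integral_add distrib_left cong: measurable_cong_sets)
  finally show ?case .
next
  case (seq U)
  note [measurable] = seq.hyps(1)
  have "(\<integral>\<^sup>+x. indicator B (fst x) * (SUP i. U i) (snd x) \<partial>P) =
      (\<integral>\<^sup>+x. (SUP i. indicator B (fst x) * U i (snd x)) \<partial>P)"
    by (simp add: SUP_apply image_comp SUP_mult_left_ennreal)
  also have "\<dots> = (SUP i. \<integral>\<^sup>+x. indicator B (fst x) * U i (snd x) \<partial>P)"
    using seq.hyps(3) by (intro nn_integral_monotone_convergence_SUP)
      (auto simp: incseq_def le_fun_def intro!: mult_left_mono)
  also have "\<dots> = (SUP i. \<integral>\<^sup>+x. indicator B (fst x) * (\<integral>\<^sup>+c. U i c \<partial>K (fst x)) \<partial>P)"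
    using seq.IH by simp
  also have "\<dots> = (\<integral>\<^sup>+x. (SUP i. indicator B (fst x) * (\<integral>\<^sup>+c. U i c \<partial>K (fst x))) \<partial>P)"
    using seq.hyps(3) by (intro nn_integral_monotone_convergence_SUP[symmetric])
      (auto simp: incseq_def le_fun_def intro!: mult_left_mono nn_integral_mono)
  \<comment> \<open>Monotone convergence once more, now under \<open>K (fst x)\<close> for each
    fixed point.\<close>
  also have "\<dots> = (\<integral>\<^sup>+x. indicator B (fst x) * (\<integral>\<^sup>+c. (SUP i. U i) c \<partial>K (fst x)) \<partial>P)"
  proof (intro nn_integral_cong)
    fix x assume "x \<in> space P"
    then have "fst x \<in> space M" by (auto simp: space_P)
    then have "(\<integral>\<^sup>+c. (SUP i. U i c) \<partial>K (fst x)) = (SUP i. \<integral>\<^sup>+c. U i c \<partial>K (fst x))"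
      using seq.hyps(1,3) by (intro nn_integral_monotone_convergence_SUP)
        (auto simp: sets_K cong: measurable_cong_sets)
    then show "(SUP i. indicator B (fst x) * (\<integral>\<^sup>+c. U i c \<partial>K (fst x))) =
        indicator B (fst x) * (\<integral>\<^sup>+c. (SUP i. U i) c \<partial>K (fst x))"
      by (simp add: SUP_apply image_comp SUP_mult_left_ennreal)
  qed
  finally show ?case .
qed

text \<open>Second half: \<open>u\<close> is fixed and \<open>h\<close> is built up from indicators.
  Integrands of product form suffice later, because costs are linear in \<open>c\<close>.\<close>

lemma nn_integral_disintegrate:
  assumes h: "h \<in> borel_measurable M" and u [measurable]: "u \<in> borel_measurable N"
  shows "(\<integral>\<^sup>+x. h (fst x) * u (snd x) \<partial>P) =
    (\<integral>\<^sup>+x. h (fst x) * (\<integral>\<^sup>+c. u c \<partial>K (fst x)) \<partial>P)"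
  using h
proof (induction rule: borel_measurable_induct)
  case (cong f g)
  have "(\<integral>\<^sup>+x. f (fst x) * v x \<partial>P) = (\<integral>\<^sup>+x. g (fst x) * v x \<partial>P)" for v
    using cong(3) by (intro nn_integral_cong) (auto simp: space_P)
  then show ?case using cong(4) by simp
next
  case (set B)
  then show ?case using u by (rule nn_integral_indicator_disintegrate)
next
  case (mult h c)
  note [measurable] = mult.hyps(2)
  show ?case using mult.IH by (simp add: mult.assoc nn_integral_cmult)
next
  case (add h k)
  note [measurable] = add.hyps(1,3)
  show ?case using add.IH by (simp add: distrib_right nn_integral_add)
next
  case (seq U)
  note [measurable] = seq.hyps(1)
  \<comment> \<open>Kept general in \<open>v\<close> because it serves both sides of the
    claim.\<close>
  have "(\<integral>\<^sup>+x. (SUP i. U i) (fst x) * v x \<partial>P) = (SUP i. \<integral>\<^sup>+x. U i (fst x) * v x \<partial>P)"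
    if [measurable]: "v \<in> borel_measurable P" for v
  proof -
    have "(\<integral>\<^sup>+x. (SUP i. U i) (fst x) * v x \<partial>P) = (\<integral>\<^sup>+x. (SUP i. U i (fst x) * v x) \<partial>P)"
      by (simp add: SUP_apply image_comp SUP_mult_right_ennreal)
    also have "\<dots> = (SUP i. \<integral>\<^sup>+x. U i (fst x) * v x \<partial>P)"
      using seq.hyps(3) by (intro nn_integral_monotone_convergence_SUP)
        (auto simp: incseq_def le_fun_def intro!: mult_right_mono)
    finally show ?thesis .
  qed
  then show ?case using seq.IH by simp
qed

section \<open>Bounded targets: conditional mean and squared error\<close>

context
  fixes u :: "'b \<Rightarrow> real" and b :: real
  assumes u [measurable]: "u \<in> borel_measurable N"
    and bound: "\<And>c. c \<in> space N \<Longrightarrow> \<bar>u c\<bar> \<le> b"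
begin

abbreviation "cmean w \<equiv> \<integral>c. u c \<partial>K w"

lemma integrable_K:
  assumes w: "w \<in> space M"
  shows "integrable (K w) u"
proof -
  interpret K: prob_space "K w" using w by (rule prob_space_K)
  show ?thesis
    using u bound w by (intro K.integrable_const_bound[of _ b])
      (auto simp: space_K sets_K cong: measurable_cong_sets)
qed

lemma cmean_bound:
  assumes w: "w \<in> space M"
  shows "\<bar>cmean w\<bar> \<le> b"
proof -
  interpret K: prob_space "K w" using w by (rule prob_space_K)
  have "cmean w \<le> b" "- b \<le> cmean w"
    using bound integrable_K[OF w] w
    by (auto simp: space_K abs_le_iff neg_le_iff_le intro!: K.integral_le_const K.integral_ge_const AE_I2)
       (smt (verit, best) space_K)
  then show ?thesis by auto
qed

lemma integrable_mult_bounded: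
  fixes h v :: "'a \<times> 'b \<Rightarrow> real"
  assumes h: "integrable P h" and [measurable]: "v \<in> borel_measurable P"
    and v: "\<And>x. x \<in> space P \<Longrightarrow> \<bar>v x\<bar> \<le> b"
  shows "integrable P (\<lambda>x. h x * v x)"
proof (rule Bochner_Integration.integrable_bound)
  show "integrable P (\<lambda>x. b * h x)" using h by simp
  show "AE x in P. norm (h x * v x) \<le> norm (b * h x)"
  proof (rule AE_I2)
    fix x assume "x \<in> space P"
    then have "\<bar>v x\<bar> \<le> \<bar>b\<bar>" using v[of x] by simp
    then show "norm (h x * v x) \<le> norm (b * h x)"
      by (simp add: abs_mult mult.commute[of "\<bar>b\<bar>"] mult_left_mono)
  qed
qed (use h in measurable)

lemma integrable_mult_target:
  fixes h :: "'a \<Rightarrow> real"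
  assumes "integrable P (\<lambda>x. h (fst x))"
  shows "integrable P (\<lambda>x. h (fst x) * u (snd x))"
  using assms bound by (intro integrable_mult_bounded) (auto simp: space_P)

lemma integrable_mult_cmean:
  fixes h :: "'a \<Rightarrow> real"
  assumes "integrable P (\<lambda>x. h (fst x))"
  shows "integrable P (\<lambda>x. h (fst x) * cmean (fst x))"
  using assms cmean_bound by (intro integrable_mult_bounded) (auto simp: space_P)

text \<open>Adding \<open>b\<close> makes \<open>u\<close> nonnegative, so the identity for
  nonnegative integrals applies. Each \<open>K w\<close> has mass one, so \<open>cmean\<close> is
  shifted by the same \<open>b\<close>, and the extra term \<open>b\<close> times the integral of
  \<open>h\<close> cancels since \<open>h\<close> is integrable.\<close>

lemma integral_disintegrate_nonneg:
  fixes h :: "'a \<Rightarrow> real"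
  assumes h [measurable]: "h \<in> borel_measurable M" and nonneg: "\<And>w. h w \<ge> 0"
    and int: "integrable P (\<lambda>x. h (fst x))"
  shows "(\<integral>x. h (fst x) * u (snd x) \<partial>P) = (\<integral>x. h (fst x) * cmean (fst x) \<partial>P)"
proof -
  have shift: "ennreal (cmean w + b) = (\<integral>\<^sup>+c. ennreal (u c + b) \<partial>K w)" if w: "w \<in> space M" for w
  proof -
    interpret K: prob_space "K w" using w by (rule prob_space_K)
    have "(\<integral>\<^sup>+c. ennreal (u c + b) \<partial>K w) = ennreal (\<integral>c. u c + b \<partial>K w)"
      using bound w integrable_K[OF w]
      by (intro nn_integral_eq_integral) (force simp: space_K abs_le_iff intro!: AE_I2)+
    then show ?thesis using integrable_K[OF w] by (simp add: K.prob_space)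
  qed
  have b1: "u (snd x) + b \<ge> 0" "cmean (fst x) + b \<ge> 0" if "x \<in> space P" for x
    using that bound[of "snd x"] cmean_bound[of "fst x"] by (auto simp: space_P)
  have "(\<integral>x. h (fst x) * (u (snd x) + b) \<partial>P) = enn2real (\<integral>\<^sup>+x. ennreal (h (fst x) * (u (snd x) + b)) \<partial>P)"
    using nonneg b1 by (intro integral_eq_nn_integral) auto
  also have "(\<integral>\<^sup>+x. ennreal (h (fst x) * (u (snd x) + b)) \<partial>P) =
      (\<integral>\<^sup>+x. ennreal (h (fst x)) * ennreal (u (snd x) + b) \<partial>P)"
    using nonneg b1 by (intro nn_integral_cong ennreal_mult) auto
  also have "\<dots> = (\<integral>\<^sup>+x. ennreal (h (fst x)) * (\<integral>\<^sup>+c. ennreal (u c + b) \<partial>K (fst x)) \<partial>P)"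
    by (rule nn_integral_disintegrate) measurable
  also have "\<dots> = (\<integral>\<^sup>+x. ennreal (h (fst x) * (cmean (fst x) + b)) \<partial>P)"
    using nonneg b1 by (intro nn_integral_cong) (auto simp: ennreal_mult space_P shift[symmetric])
  also have "enn2real \<dots> = (\<integral>x. h (fst x) * (cmean (fst x) + b) \<partial>P)"
    using nonneg b1 by (intro integral_eq_nn_integral[symmetric]) auto
  finally show ?thesis
    using integrable_mult_target[OF int] integrable_mult_cmean[OF int] int
    by (simp add: distrib_left)
qed

text \<open>The positive and negative parts of \<open>h\<close> are integrable and fall under the
  nonnegative case; the claim follows by subtraction.\<close>

lemma integral_disintegrate:
  fixes h :: "'a \<Rightarrow> real"
  assumes h [measurable]: "h \<in> borel_measurable M" and int: "integrable P (\<lambda>x. h (fst x))"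
  shows "(\<integral>x. h (fst x) * u (snd x) \<partial>P) = (\<integral>x. h (fst x) * cmean (fst x) \<partial>P)"
proof -
  define p n where "p w = max 0 (h w)" and "n w = max 0 (- h w)" for w
  have pn: "h w = p w - n w" for w by (auto simp: p_def n_def)
  have int_p: "integrable P (\<lambda>x. p (fst x))" and int_n: "integrable P (\<lambda>x. n (fst x))"
    using int by (auto simp: p_def n_def intro!: integrable_max)
  have "p \<in> borel_measurable M" "n \<in> borel_measurable M"
    unfolding p_def n_def by measurable
  then have "(\<integral>x. p (fst x) * u (snd x) \<partial>P) = (\<integral>x. p (fst x) * cmean (fst x) \<partial>P)"
      "(\<integral>x. n (fst x) * u (snd x) \<partial>P) = (\<integral>x. n (fst x) * cmean (fst x) \<partial>P)"
    using int_p int_n by (auto intro!: integral_disintegrate_nonneg simp: p_def n_def)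
  then show ?thesis
    using integrable_mult_target[OF int_p] integrable_mult_target[OF int_n]
      integrable_mult_cmean[OF int_p] integrable_mult_cmean[OF int_n]
    by (simp add: pn left_diff_distrib)
qed

lemma integrable_target: "integrable P (\<lambda>x. u (snd x))"
  using integrable_mult_target[of "\<lambda>_. 1"] by simp

lemma integrable_cmean: "integrable P (\<lambda>x. cmean (fst x))"
  using integrable_mult_cmean[of "\<lambda>_. 1"] by simp

text \<open>\<open>u - cmean\<close> is orthogonal to every integrable function of \<open>w\<close>.\<close>

lemma squared_error_decomposition:
  fixes h :: "'a \<Rightarrow> real"
  assumes h [measurable]: "h \<in> borel_measurable M"
    and int: "integrable P (\<lambda>x. (h (fst x) - u (snd x))\<^sup>2)"
  shows "integrable P (\<lambda>x. (cmean (fst x) - u (snd x))\<^sup>2)"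
    and "integrable P (\<lambda>x. (h (fst x) - cmean (fst x))\<^sup>2)"
    and "(\<integral>x. (h (fst x) - cmean (fst x))\<^sup>2 \<partial>P) =
      (\<integral>x. (h (fst x) - u (snd x))\<^sup>2 \<partial>P) - (\<integral>x. (cmean (fst x) - u (snd x))\<^sup>2 \<partial>P)"
proof -
  \<comment> \<open>Integrability of \<open>h\<close> is not assumed. It follows from the square
    integrable error and the bounded target.\<close>
  have "integrable P (\<lambda>x. h (fst x) - u (snd x))"
    by (rule square_integrable_imp_integrable[OF _ int]) measurable
  from Bochner_Integration.integrable_add[OF this integrable_target]
  have int_h: "integrable P (\<lambda>x. h (fst x))" by simp
  define k where "k w = h w - cmean w" for w
  have [measurable]: "k \<in> borel_measurable M" unfolding k_def by measurable
  have int_k: "integrable P (\<lambda>x. k (fst x))"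
    unfolding k_def using int_h integrable_cmean by simp
  have cc: "integrable P (\<lambda>x. cmean (fst x) * cmean (fst x))"
    by (rule integrable_mult_cmean[OF integrable_cmean])
  have cu: "integrable P (\<lambda>x. cmean (fst x) * u (snd x))"
    by (rule integrable_mult_target[OF integrable_cmean])
  have uu: "integrable P (\<lambda>x. u (snd x) * u (snd x))"
    using integrable_target bound by (intro integrable_mult_bounded) (auto simp: space_P)
  have "integrable P (\<lambda>x. cmean (fst x) * cmean (fst x) - 2 * (cmean (fst x) * u (snd x)) + u (snd x) * u (snd x))"
    using cc cu uu by simp
  then show 1: "integrable P (\<lambda>x. (cmean (fst x) - u (snd x))\<^sup>2)"
    by (simp add: power2_eq_square algebra_simps)
  note ku = integrable_mult_target[OF int_k] and kc = integrable_mult_cmean[OF int_k]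
  \<comment> \<open>Expansion of the square of \<open>h - u = k + (cmean - u)\<close>. The cross
    term is integrable because \<open>k\<close> is integrable and \<open>u\<close> and
    \<open>cmean\<close> are bounded, so square integrability of \<open>k\<close> is a result here
    and not a premise; \<open>integral_disintegrate\<close> makes its integral vanish.\<close>
  have eq: "(h (fst x) - cmean (fst x))\<^sup>2 = (h (fst x) - u (snd x))\<^sup>2 - (cmean (fst x) - u (snd x))\<^sup>2
      - 2 * (k (fst x) * cmean (fst x) - k (fst x) * u (snd x))" for x
    by (simp add: k_def power2_eq_square algebra_simps)
  show "integrable P (\<lambda>x. (h (fst x) - cmean (fst x))\<^sup>2)"
    unfolding eq using int 1 ku kc by simp
  show "(\<integral>x. (h (fst x) - cmean (fst x))\<^sup>2 \<partial>P) =
      (\<integral>x. (h (fst x) - u (snd x))\<^sup>2 \<partial>P) - (\<integral>x. (cmean (fst x) - u (snd x))\<^sup>2 \<partial>P)"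
    unfolding eq using int 1 ku kc integral_disintegrate[OF _ int_k] by simp
qed

end

end


section \<open>Facts on vectors, minimizers and second moments\<close>

lemma borel_measurable_vecI:
  fixes v :: "'a \<Rightarrow> real^'n"
  assumes "\<And>j. (\<lambda>w. v w $ j) \<in> borel_measurable M"
  shows "v \<in> borel_measurable M"
  using assms by (subst borel_measurable_euclidean_space) (auto simp: Basis_vec_def inner_axis)

lemma argmin_setD:
  assumes "z \<in> argmin_set X f d"
  shows "z \<in> X" and "\<And>x. x \<in> X \<Longrightarrow> f z + d \<bullet> z \<le> f x + d \<bullet> x"
  using assms by (auto simp: argmin_set_def is_arg_min_def not_less)

lemma argmin_set_INF:
  assumes "z \<in> argmin_set X f d"
  shows "(INF x\<in>X. f x + d \<bullet> x) = f z + d \<bullet> z"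
  using argmin_setD[OF assms] by (intro cInf_eq_minimum) auto

text \<open>The minimizer for \<open>e\<close> competes at \<open>d\<close>, and conversely, so the
  two minima differ by at most \<open>norm (d - e)\<close> times a bound on \<open>X\<close>. The
  minimum is thus Lipschitz in the cost vector even where \<open>xs\<close> jumps, which later gives
  its measurability.\<close>

lemma argmin_set_value_continuous:
  assumes X: "bounded X" and xs: "\<And>d. xs d \<in> argmin_set X f d"
  shows "continuous_on UNIV (\<lambda>d. f (xs d) + d \<bullet> xs d)"
proof -
  obtain B where B: "B > 0" "\<And>x. x \<in> X \<Longrightarrow> norm x \<le> B"
    using X by (auto simp: bounded_pos)
  have le: "f (xs d) + d \<bullet> xs d \<le> f (xs e) + e \<bullet> xs e + B * norm (d - e)" for d e
  proof -
    have "f (xs d) + d \<bullet> xs d \<le> f (xs e) + d \<bullet> xs e"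
      using argmin_setD[OF xs] by blast
    also have "\<dots> = f (xs e) + e \<bullet> xs e + (d - e) \<bullet> xs e"
      by (simp add: inner_diff_left)
    also have "(d - e) \<bullet> xs e \<le> norm (d - e) * norm (xs e)"
      by (rule norm_cauchy_schwarz)
    also have "\<dots> \<le> norm (d - e) * B"
      using B argmin_setD(1)[OF xs] by (intro mult_left_mono) auto
    finally show ?thesis by (simp add: mult.commute)
  qed
  have "B-lipschitz_on UNIV (\<lambda>d. f (xs d) + d \<bullet> xs d)"
  proof (rule lipschitz_onI)
    fix d e
    show "dist (f (xs d) + d \<bullet> xs d) (f (xs e) + e \<bullet> xs e) \<le> B * dist d e"
      using le[of d e] le[of e d] by (auto simp: dist_norm norm_minus_commute abs_le_iff)
  qed (use B in simp)
  then show ?thesis by (rule lipschitz_on_continuous_on)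
qed

text \<open>Jensen's inequality for the square, read off from the nonnegativity of the
  variance.\<close>

lemma (in prob_space) expectation_le_sqrt:
  fixes Y :: "'a \<Rightarrow> real"
  assumes [measurable]: "Y \<in> borel_measurable M" and int: "integrable M (\<lambda>x. (Y x)\<^sup>2)"
  shows "expectation Y \<le> sqrt (expectation (\<lambda>x. (Y x)\<^sup>2))"
proof -
  have "integrable M Y" by (rule square_integrable_imp_integrable[OF _ int]) measurable
  from variance_eq[OF this int] variance_positive[of Y]
  have "(expectation Y)\<^sup>2 \<le> expectation (\<lambda>x. (Y x)\<^sup>2)" by simp
  then show ?thesis by (rule real_le_rsqrt)
qed

section \<open>Bounded cost vectors and their conditional mean\<close>

lemma disintegration_cond_distr:
  assumes P: "prob_space P" and sets: "sets P = sets (lebesgue_on (W \<times> C))"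
    and K: "is_cond_distr W C P K"
  shows "disintegration P (lebesgue_on W) (lebesgue_on C) K"
proof -
  interpret prob_space P by fact
  have fst: "fst \<in> P \<rightarrow>\<^sub>M lebesgue_on W"
    unfolding measurable_cong_sets[OF sets refl]
    by (intro measurable_restrict_space3 measurable_lebesgue_fst) auto
  have snd: "snd \<in> P \<rightarrow>\<^sub>M lebesgue_on C"
    unfolding measurable_cong_sets[OF sets refl]
    by (intro measurable_restrict_space3 measurable_lebesgue_snd) auto
  show ?thesis
    using K sets_eq_imp_space_eq[OF sets] fst snd
    by unfold_locales (auto simp: is_cond_distr_def)
qed

locale bounded_target = disintegration P "lebesgue_on W" "lebesgue_on C" K
  for P :: "((real^'k) \<times> (real^'m)) measure" and W C K +
  fixes b :: real
  assumes norm_target: "\<And>c. c \<in> C \<Longrightarrow> norm c \<le> b"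
begin

text \<open>Taken coordinate by coordinate, so that the scalar results on \<open>cmean\<close> apply
  to each entry directly.\<close>

definition cond_mean :: "real^'k \<Rightarrow> real^'m" where
  "cond_mean w = (\<chi> j. \<integral>c. c $ j \<partial>K w)"

lemma measurable_nth [measurable]: "(\<lambda>c. c $ j) \<in> borel_measurable (lebesgue_on C)"
  by (intro measurable_restrict_space1 measurable_completion) simp

lemma target_nth_bound: "c \<in> space (lebesgue_on C) \<Longrightarrow> \<bar>c $ j\<bar> \<le> b"
  using norm_target[of c] component_le_norm_cart[of c j] by simp

lemma cond_mean_nth_measurable [measurable]:
  "(\<lambda>w. cond_mean w $ j) \<in> borel_measurable (lebesgue_on W)"
  unfolding cond_mean_def by simp

lemma measurable_target [measurable]: "(\<lambda>x. snd x) \<in> borel_measurable P"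
  by (rule measurable_compose[OF measurable_snd_P])
     (intro measurable_restrict_space1 measurable_completion, simp)

text \<open>The inner product is a finite sum of products of a bounded function of \<open>w\<close>
  with one bounded coordinate of \<open>c\<close>; the scalar disintegration applies to each
  summand. This is the tower property in vector form.\<close>

lemma integrable_inner:
  assumes [measurable]: "v \<in> borel_measurable (lebesgue_on W)"
    and v: "\<And>w. w \<in> W \<Longrightarrow> norm (v w) \<le> r"
  shows "integrable P (\<lambda>x. snd x \<bullet> v (fst x))"
    and "integrable P (\<lambda>x. cond_mean (fst x) \<bullet> v (fst x))"
    and "(\<integral>x. snd x \<bullet> v (fst x) \<partial>P) = (\<integral>x. cond_mean (fst x) \<bullet> v (fst x) \<partial>P)"
proof -
  have [measurable]: "(\<lambda>w. v w $ j) \<in> borel_measurable (lebesgue_on W)" for j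
    by (rule measurable_compose[OF assms(1) borel_measurable_nth])
  have int: "integrable P (\<lambda>x. v (fst x) $ j)" for j
    using order_trans[OF component_le_norm_cart v]
    by (intro integrable_const_bound[of _ r] AE_I2) (auto simp: space_P)
  note target = integrable_mult_target[OF measurable_nth target_nth_bound int]
    and cmean = integrable_mult_cmean[OF measurable_nth target_nth_bound int]
  show "integrable P (\<lambda>x. snd x \<bullet> v (fst x))"
    using target by (simp add: inner_vec_def mult.commute)
  show "integrable P (\<lambda>x. cond_mean (fst x) \<bullet> v (fst x))"
    using cmean by (simp add: inner_vec_def cond_mean_def mult.commute)
  show "(\<integral>x. snd x \<bullet> v (fst x) \<partial>P) = (\<integral>x. cond_mean (fst x) \<bullet> v (fst x) \<partial>P)"
    using target cmean integral_disintegrate[OF measurable_nth target_nth_bound _ int]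
    by (simp add: inner_vec_def cond_mean_def mult.commute)
qed

text \<open>The infimum \<open>I\<close> is finite, so a finite excess forces a finite squared loss
  of \<open>h\<close>. The squared distance to the conditional mean is then the loss of
  \<open>h\<close> minus the loss of the conditional mean, and the latter is at least
  \<open>I\<close>.\<close>

lemma cond_mean_excess:
  assumes h [measurable]: "h \<in> borel_measurable (lebesgue_on W)"
    and fin: "excess W P squared_loss j h < \<infinity>"
  shows "integrable P (\<lambda>x. (h (fst x) - cond_mean (fst x) $ j)\<^sup>2)"
    and "ereal (\<integral>x. (h (fst x) - cond_mean (fst x) $ j)\<^sup>2 \<partial>P) \<le> excess W P squared_loss j h"
proof -
  define I where "I = (INF h'\<in>borel_measurable (lebesgue_on W). expected_loss P squared_loss j h')"
  \<comment> \<open>The negative part of the loss vanishes, so this formula also covers infinite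
    expected loss.\<close>
  have el: "expected_loss P squared_loss j k = enn2ereal (\<integral>\<^sup>+x. ennreal ((k (fst x) - snd x $ j)\<^sup>2) \<partial>P)"
    if [measurable]: "k \<in> borel_measurable (lebesgue_on W)" for k
    by (simp add: expected_loss_def ext_expectation_def squared_loss_def case_prod_beta ennreal_neg
        zero_ennreal.rep_eq)
  have el_int: "expected_loss P squared_loss j k = ereal (\<integral>x. (k (fst x) - snd x $ j)\<^sup>2 \<partial>P)"
    if "integrable P (\<lambda>x. (k (fst x) - snd x $ j)\<^sup>2)" for k
    using that unfolding expected_loss_def
    by (subst ext_expectation_integrable) (simp_all add: squared_loss_def case_prod_beta')
  \<comment> \<open>The constant predictor 0 has finite loss because the target is bounded; it
    witnesses that \<open>I\<close> is finite.\<close>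
  have zero: "integrable P (\<lambda>x. (0 - snd x $ j)\<^sup>2)"
    using order_trans[OF target_nth_bound abs_ge_self]
    by (intro integrable_const_bound[of _ "b\<^sup>2"] AE_I2)
      (auto simp: space_P simp flip: abs_le_square_iff)
  have "I \<le> expected_loss P squared_loss j (\<lambda>_. 0)"
    unfolding I_def by (intro INF_lower) simp
  also have "\<dots> < \<infinity>" using el_int[of "\<lambda>_. 0"] zero by simp
  finally have I_less: "I < \<infinity>" .
  have I_nonneg: "0 \<le> I"
    unfolding I_def by (intro INF_greatest) (simp add: el)
  have ex: "excess W P squared_loss j h = expected_loss P squared_loss j h - I"
    by (simp add: excess_def I_def)
  have "expected_loss P squared_loss j h < \<infinity>"
    using fin I_less I_nonneg unfolding ex by (cases I; cases "expected_loss P squared_loss j h") auto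
  then have "(\<integral>\<^sup>+x. ennreal ((h (fst x) - snd x $ j)\<^sup>2) \<partial>P) < \<infinity>"
    unfolding el[OF h] by (simp add: less_ennreal.rep_eq top_ennreal.rep_eq)
  then have int: "integrable P (\<lambda>x. (h (fst x) - snd x $ j)\<^sup>2)"
    by (intro integrableI_nonneg) auto
  note dec = squared_error_decomposition[OF measurable_nth target_nth_bound h int]
  then show "integrable P (\<lambda>x. (h (fst x) - cond_mean (fst x) $ j)\<^sup>2)"
    by (simp add: cond_mean_def)
  have "I \<le> expected_loss P squared_loss j (\<lambda>w. cond_mean w $ j)"
    unfolding I_def by (intro INF_lower) measurable
  also have "\<dots> = ereal (\<integral>x. (cond_mean (fst x) $ j - snd x $ j)\<^sup>2 \<partial>P)"
    using dec(1) by (intro el_int) (simp add: cond_mean_def)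
  finally have "ereal (\<integral>x. (h (fst x) - snd x $ j)\<^sup>2 \<partial>P)
      - ereal (\<integral>x. (cond_mean (fst x) $ j - snd x $ j)\<^sup>2 \<partial>P) \<le> excess W P squared_loss j h"
    unfolding ex el_int[OF int] by (intro ereal_minus_mono) auto
  then show "ereal (\<integral>x. (h (fst x) - cond_mean (fst x) $ j)\<^sup>2 \<partial>P) \<le> excess W P squared_loss j h"
    using dec(3) by (simp add: cond_mean_def)
qed

section \<open>Risk differences between decision rules\<close>

context
  fixes X :: "(real^'m) set" and f :: "real^'m \<Rightarrow> real" and xs :: "real^'m \<Rightarrow> real^'m"
  assumes X: "compact X" and f: "continuous_on X f" and xs: "\<And>d. xs d \<in> argmin_set X f d"
begin

text \<open>Outside \<open>X\<close> nothing is known about \<open>f\<close>, so it is replaced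
  there by 0, which yields a Borel function. Decisions lie in \<open>X\<close>, hence the
  composition is unchanged.\<close>

lemma measurable_decision_cost:
  assumes g: "g \<in> predictors W xs"
  shows "(\<lambda>w. f (xs (g w))) \<in> borel_measurable (lebesgue_on W)"
proof -
  have "(\<lambda>x. indicator X x *\<^sub>R f x) \<in> borel_measurable borel"
    using X f by (intro borel_measurable_continuous_on_indicator) (auto simp: borel_compact)
  from measurable_compose[OF _ this, of "\<lambda>w. xs (g w)"] g
  show ?thesis using argmin_setD(1)[OF xs] by (simp add: predictors_def)
qed

text \<open>Decisions, their costs \<open>f\<close> and the vectors \<open>c\<close> are all
  bounded, so the risk is a genuine integral and splits into its summands.\<close>

lemma integrable_true_loss:
  assumes g: "g \<in> predictors W xs"
  shows "integrable P (\<lambda>x. f (xs (g (fst x))))"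
    and "integrable P (\<lambda>x. snd x \<bullet> xs (g (fst x)))"
    and "integrable P (\<lambda>x. cond_mean (fst x) \<bullet> xs (g (fst x)))"
    and "(\<integral>x. snd x \<bullet> xs (g (fst x)) \<partial>P) = (\<integral>x. cond_mean (fst x) \<bullet> xs (g (fst x)) \<partial>P)"
    and "integrable P (\<lambda>x. true_loss X f xs (g (fst x)) (snd x))"
proof -
  note [measurable] = measurable_decision_cost[OF g]
  obtain r where r: "\<And>x. x \<in> X \<Longrightarrow> norm x \<le> r"
    using compact_imp_bounded[OF X] by (auto simp: bounded_iff)
  obtain F where F: "\<And>x. x \<in> X \<Longrightarrow> \<bar>f x\<bar> \<le> F"
    using compact_imp_bounded[OF compact_continuous_image[OF f X]] by (auto simp: bounded_iff)
  have xsX: "xs d \<in> X" for d using argmin_setD(1)[OF xs] .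
  show 1: "integrable P (\<lambda>x. f (xs (g (fst x))))"
    using F xsX by (intro integrable_const_bound[of _ F]) auto
  have m: "(\<lambda>w. xs (g w)) \<in> borel_measurable (lebesgue_on W)"
    using g by (simp add: predictors_def)
  note inner = integrable_inner[OF m, of r]
  show 2: "integrable P (\<lambda>x. snd x \<bullet> xs (g (fst x)))"
    "integrable P (\<lambda>x. cond_mean (fst x) \<bullet> xs (g (fst x)))"
    "(\<integral>x. snd x \<bullet> xs (g (fst x)) \<partial>P) = (\<integral>x. cond_mean (fst x) \<bullet> xs (g (fst x)) \<partial>P)"
    using inner r xsX by auto
  \<comment> \<open>Measurability of the minimum in \<open>c\<close> comes from its continuity; no
    Borel measurability of \<open>xs\<close> is assumed.\<close>
  have [measurable]: "(\<lambda>d. f (xs d) + d \<bullet> xs d) \<in> borel_measurable borel"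
    by (intro borel_measurable_continuous_onI argmin_set_value_continuous[OF compact_imp_bounded[OF X] xs])
  have "\<bar>f (xs c) + c \<bullet> xs c\<bar> \<le> F + b * r" if "c \<in> C" for c
  proof -
    have "\<bar>c \<bullet> xs c\<bar> \<le> norm c * norm (xs c)" by (rule Cauchy_Schwarz_ineq2)
    also have "\<dots> \<le> b * r"
      using norm_target[OF that] r[OF xsX] by (intro mult_mono) (auto intro: order_trans[OF norm_ge_zero])
    finally show ?thesis using F[OF xsX, of c] by linarith
  qed
  then have "integrable P (\<lambda>x. f (xs (snd x)) + snd x \<bullet> xs (snd x))"
    by (intro integrable_const_bound[of _ "F + b * r"]) (auto simp: space_P)
  then show "integrable P (\<lambda>x. true_loss X f xs (g (fst x)) (snd x))"
    using 1 2 by (simp add: true_loss_def argmin_set_INF[OF xs])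
qed

lemma risk_diff_le:
  assumes g: "g \<in> predictors W xs" and g': "g' \<in> predictors W xs"
    and int: "integrable P (\<lambda>x. (norm (cond_mean (fst x) - g (fst x)))\<^sup>2)"
  shows "risk X f xs g P - risk X f xs g' P
    \<le> diameter X * sqrt (\<integral>x. (norm (cond_mean (fst x) - g (fst x)))\<^sup>2 \<partial>P)"
proof -
  note ig = integrable_true_loss[OF g] and ig' = integrable_true_loss[OF g']
  have [measurable]: "cond_mean \<in> borel_measurable (lebesgue_on W)"
    by (rule borel_measurable_vecI) measurable
  have [measurable]: "g \<in> borel_measurable (lebesgue_on W)"
    using g by (simp add: predictors_def)
  have int1: "integrable P (\<lambda>x. norm (cond_mean (fst x) - g (fst x)))"
    by (rule square_integrable_imp_integrable[OF _ int]) measurable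
  have xsX: "xs d \<in> X" for d using argmin_setD(1)[OF xs] .
  have "risk X f xs g P - risk X f xs g' P =
      (\<integral>x. true_loss X f xs (g (fst x)) (snd x) - true_loss X f xs (g' (fst x)) (snd x) \<partial>P)"
    using ig ig' by (simp add: risk_def case_prod_beta')
  \<comment> \<open>The minimum over \<open>X\<close> depends on \<open>c\<close> alone and
    cancels.\<close>
  also have "\<dots> = (\<integral>x. (f (xs (g (fst x))) + snd x \<bullet> xs (g (fst x)))
      - (f (xs (g' (fst x))) + snd x \<bullet> xs (g' (fst x))) \<partial>P)"
    by (intro Bochner_Integration.integral_cong) (simp_all add: true_loss_def)
  \<comment> \<open>What remains is linear in \<open>c\<close> against functions of
    \<open>w\<close>, so \<open>c\<close> may be replaced by its conditional mean.\<close>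
  also have "\<dots> = (\<integral>x. (f (xs (g (fst x))) + cond_mean (fst x) \<bullet> xs (g (fst x)))
      - (f (xs (g' (fst x))) + cond_mean (fst x) \<bullet> xs (g' (fst x))) \<partial>P)"
    using ig(1-4) ig'(1-4) by simp
  also have "\<dots> \<le> (\<integral>x. norm (cond_mean (fst x) - g (fst x)) * diameter X \<partial>P)"
  proof (rule integral_mono)
    fix x
    let ?y = "xs (g (fst x))" and ?z = "xs (g' (fst x))"
    have "f ?y + cond_mean (fst x) \<bullet> ?y - (f ?z + cond_mean (fst x) \<bullet> ?z)
        \<le> (cond_mean (fst x) - g (fst x)) \<bullet> (?y - ?z)"
      using argmin_setD(2)[OF xs xsX, of "g (fst x)" "g' (fst x)"]
      by (simp add: inner_diff_left inner_diff_right)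
    also have "\<dots> \<le> norm (cond_mean (fst x) - g (fst x)) * norm (?y - ?z)"
      by (rule norm_cauchy_schwarz)
    also have "\<dots> \<le> norm (cond_mean (fst x) - g (fst x)) * diameter X"
      using diameter_bounded_bound[OF compact_imp_bounded[OF X] xsX xsX]
      by (intro mult_left_mono) (simp_all add: dist_norm)
    finally show "f ?y + cond_mean (fst x) \<bullet> ?y - (f ?z + cond_mean (fst x) \<bullet> ?z)
        \<le> norm (cond_mean (fst x) - g (fst x)) * diameter X" .
  qed (use ig(1-4) ig'(1-4) int1 in simp_all)
  also have "\<dots> = diameter X * (\<integral>x. norm (cond_mean (fst x) - g (fst x)) \<partial>P)"
    by simp
  also have "\<dots> \<le> diameter X * sqrt (\<integral>x. (norm (cond_mean (fst x) - g (fst x)))\<^sup>2 \<partial>P)"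
    using diameter_ge_0[OF compact_imp_bounded[OF X]] int
    by (intro mult_left_mono expectation_le_sqrt) measurable
  finally show ?thesis .
qed

end

end

section \<open>From coordinatewise calibration to the regret bound\<close>

theorem lemma7:
  fixes X :: "(real^'m) set" and f :: "real^'m \<Rightarrow> real" and xs :: "real^'m \<Rightarrow> real^'m"
    and W :: "(real^'k) set" and C :: "(real^'m) set"
    and l :: "'m \<Rightarrow> real \<times> real \<Rightarrow> real" and \<eta> :: "'m \<Rightarrow> real \<Rightarrow> real"
    and g :: "'m \<Rightarrow> real^'k \<Rightarrow> real" and P :: "((real^'k) \<times> (real^'m)) measure"
  assumes X: "X \<noteq> {}" "convex X" "compact X"
    and f: "convex_on X f" "continuous_on X f"
    and xs: "\<And>d. xs d \<in> argmin_set X f d"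
    and C: "bounded C"
    and l_measurable: "\<And>j. l j \<in> borel_measurable lebesgue"
    and \<eta>_pos: "\<And>j. \<eta> j \<in> {0<..} \<rightarrow> {0<..}"
    and \<eta>_mono: "\<And>j. mono_on {0<..} (\<eta> j)"
    and calibration: "\<And>j h Q. \<lbrakk>h \<in> borel_measurable (lebesgue_on W); Q \<in> distribution_class W C;
            \<bar>excess W Q (l j) j h\<bar> \<noteq> \<infinity>\<rbrakk> \<Longrightarrow>
          excess W Q squared_loss j h \<le> ereal (\<eta> j (real_of_ereal (excess W Q (l j) j h)))"
    and g_measurable: "\<And>j. g j \<in> borel_measurable (lebesgue_on W)"
    and decision_measurable: "(\<lambda>w. xs (\<chi> j. g j w)) \<in> borel_measurable (lebesgue_on W)"
    and P: "P \<in> distribution_class W C"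
    and finite_excess: "\<And>j. \<bar>excess W P (l j) j (g j)\<bar> \<noteq> \<infinity>"
  shows "risk X f xs (\<lambda>w. \<chi> j. g j w) P - optimal_risk W X f xs P
    \<le> diameter X * sqrt (\<Sum>j\<in>UNIV. \<eta> j (real_of_ereal (excess W P (l j) j (g j))))"
proof -
  obtain K where "prob_space P" "sets P = sets (lebesgue_on (W \<times> C))" "is_cond_distr W C P K"
    using P by (auto simp: distribution_class_def)
  then interpret disintegration P "lebesgue_on W" "lebesgue_on C" K
    by (rule disintegration_cond_distr)
  obtain b where "\<And>c. c \<in> C \<Longrightarrow> norm c \<le> b"
    using C by (auto simp: bounded_iff)
  then interpret bounded_target P W C K b
    by unfold_locales
  let ?g = "\<lambda>w. \<chi> j. g j w"
  let ?S = "\<Sum>j\<in>UNIV. \<eta> j (real_of_ereal (excess W P (l j) j (g j)))"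
  have [measurable]: "?g \<in> borel_measurable (lebesgue_on W)"
    using g_measurable by (intro borel_measurable_vecI) simp
  have g: "?g \<in> predictors W xs"
    using decision_measurable by (simp add: predictors_def)
  note cal = calibration[OF g_measurable P finite_excess]
  \<comment> \<open>Calibration bounds the squared excess by a real number, which supplies the
    finiteness that \<open>cond_mean_excess\<close> requires.\<close>
  have "excess W P squared_loss j (g j) < \<infinity>" for j
    using cal[of j] by (rule le_less_trans) simp
  note ex = cond_mean_excess[OF g_measurable this]
  have sq: "(norm (cond_mean w - ?g w))\<^sup>2 = (\<Sum>j\<in>UNIV. (g j w - cond_mean w $ j)\<^sup>2)" for w
    by (simp add: power2_norm_eq_inner inner_vec_def power2_commute flip: power2_eq_square)
  have int: "integrable P (\<lambda>x. (norm (cond_mean (fst x) - ?g (fst x)))\<^sup>2)"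
    unfolding sq using ex(1) by simp
  have "(\<integral>x. (norm (cond_mean (fst x) - ?g (fst x)))\<^sup>2 \<partial>P) =
      (\<Sum>j\<in>UNIV. \<integral>x. (g j (fst x) - cond_mean (fst x) $ j)\<^sup>2 \<partial>P)"
    unfolding sq using ex(1) by simp
  also have "\<dots> \<le> ?S"
    using order_trans[OF ex(2) cal] by (intro sum_mono) simp
  finally have le: "diameter X * sqrt (\<integral>x. (norm (cond_mean (fst x) - ?g (fst x)))\<^sup>2 \<partial>P)
      \<le> diameter X * sqrt ?S"
    using diameter_ge_0[OF compact_imp_bounded[OF X(3)]] by (intro mult_left_mono) auto
  \<comment> \<open>A bound for every competing predictor passes to the infimum; \<open>?g\<close>
    itself shows that the set of predictors is non-empty, as the real infimum requires.\<close>
  have "risk X f xs ?g P - diameter X * sqrt ?S \<le> optimal_risk W X f xs P"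
    unfolding optimal_risk_def
  proof (rule cINF_greatest)
    fix g' assume "g' \<in> predictors W xs"
    from risk_diff_le[OF X(3) f(2) xs g this int] le
    show "risk X f xs ?g P - diameter X * sqrt ?S \<le> risk X f xs g' P" by linarith
  qed (use g in auto)
  then show ?thesis by simp
qed

end
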